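(* Let $S=K[x_1,\ldots,x_n]$ be a standard graded polynomial ring over a field $K$ and let $I\subset S$ be a nonzero proper equigenerated graded ideal with the strong persistence property, i.e. $(I^{k+1}:I)=I^k$ for all $k\geq 1$. If $\mathrm{v}_{\mathfrak{p}}(I)=\alpha(I)-\alpha(\mathfrak{p})$ for some $\mathfrak{p}\in\operatorname{Ass}(I)$, then $\mathrm{v}_{\mathfrak{p}}(I^k)=\alpha(I)k-\alpha(\mathfrak{p})$ for all $k\geq1$. In particular, if $\mathrm{v}(I)=\alpha(I)-c(I)$, then $\mathrm{v}(I^k)=\alpha(I)k-c(I)$ for all $k\geq 1$.
   Context: $S=\bigoplus_{d\ge 0}S_d$ is graded with $\deg x_i=1$. A graded ideal is equigenerated if it is generated by homogeneous elements all of the same degree. $\operatorname{Ass}(I)$ denotes the set of associated primes of $I$ (i.e. of $S/I$). For a nonzero graded ideal $I$, $\alpha(I):=\min\{\deg(f)\mid f\in I\setminus\{0\}\}$ (over homogeneous $f$). $c(I):=\max\{\alpha(\mathfrak{p})\mid \mathfrak{p}\in\operatorname{Ass}(I)\}$. For a proper graded ideal $I$ and $\mathfrak{p}\in\operatorname{Ass}(I)$, $\mathrm{v}_{\mathfrak{p}}(I):=\min\{d\geq 0\mid \exists f\in S_d \text{ with } (I:f)=\mathfrak{p}\}$, and $\mathrm{v}(I):=\min\{d\geq 0\mid \exists f\in S_d,\ \mathfrak{p}\in\operatorname{Ass}(I)\text{ with }(I:f)=\mathfrak{p}\}$. Here $(I:J)=\{g\in S\mid gJ\subseteq I\}$ and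 $(I:f)=(I:\langle f\rangle)$. *)

theory Defs
  imports "HOL-Library.Poly_Mapping" "HOL-Algebra.Algebraic_Closure_Type"
    "HOL-Algebra.Ideal_Product"
begin

text \<open>
  The polynomial ring \<open>K[x\<^sub>1, \<dots>, x\<^sub>n]\<close> is the monoid algebra of the exponent vectors
  \<open>'n \<Rightarrow>\<^sub>0 nat\<close> over \<open>'k\<close>, where \<open>n\<close> is the cardinality of the finite type \<open>'n\<close>
  (for \<open>n = 0\<close> there is no nonzero proper ideal).  The record \<open>mpoly_ring\<close> views this type
  as a ring with carrier \<open>UNIV\<close>, so that the ideal theory of HOL-Algebra applies.
\<close>

type_synonym ('n, 'k) mpoly = "('n \<Rightarrow>\<^sub>0 nat) \<Rightarrow>\<^sub>0 'k"

abbreviation mpoly_ring :: "('n::finite, 'k::field) mpoly ring" where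
  "mpoly_ring \<equiv> ring_of_type_algebra"

definition mdeg :: "('n::finite \<Rightarrow>\<^sub>0 nat) \<Rightarrow> nat" where
  "mdeg m = (\<Sum>i\<in>UNIV. Poly_Mapping.lookup m i)"

text \<open>The graded component \<open>S\<^sub>d\<close>; it contains \<open>0\<close>.\<close>

definition graded_part :: "nat \<Rightarrow> ('n::finite, 'k::field) mpoly set" where
  "graded_part d = {f. \<forall>m\<in>Poly_Mapping.keys f. mdeg m = d}"

definition graded_ideal :: "('n::finite, 'k::field) mpoly set \<Rightarrow> bool" where
  "graded_ideal I \<longleftrightarrow> (\<exists>G \<subseteq> (\<Union>d. graded_part d). I = Idl\<^bsub>mpoly_ring\<^esub> G)"

definition equigenerated :: "('n::finite, 'k::field) mpoly set \<Rightarrow> bool" where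
  "equigenerated I \<longleftrightarrow> (\<exists>d. \<exists>G \<subseteq> graded_part d. I = Idl\<^bsub>mpoly_ring\<^esub> G)"

definition ideal_power ::
    "('n::finite, 'k::field) mpoly set \<Rightarrow> nat \<Rightarrow> ('n, 'k) mpoly set" where
  "ideal_power I k = I [^]\<^bsub>ideals_set mpoly_ring\<^esub> k"

definition colon ::
    "('n::finite, 'k::field) mpoly set \<Rightarrow> ('n, 'k) mpoly set \<Rightarrow>
     ('n, 'k) mpoly set" where
  "colon I J = {g. \<forall>h\<in>J. g * h \<in> I}"

definition colon_elem ::
    "('n::finite, 'k::field) mpoly set \<Rightarrow> ('n, 'k) mpoly \<Rightarrow>
     ('n, 'k) mpoly set" where
  "colon_elem I f = colon I (Idl\<^bsub>mpoly_ring\<^esub> {f})"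

definition strong_persistence :: "('n::finite, 'k::field) mpoly set \<Rightarrow> bool" where
  "strong_persistence I \<longleftrightarrow> (\<forall>k\<ge>1. colon (ideal_power I (k + 1)) I = ideal_power I k)"

text \<open>
  The associated primes of \<open>S/I\<close>: the annihilator of the class of \<open>f\<close> in \<open>S/I\<close> is \<open>(I : f)\<close>.
  Here \<open>f\<close> is an arbitrary, not necessarily homogeneous, polynomial.
\<close>

definition Ass ::
    "('n::finite, 'k::field) mpoly set \<Rightarrow> ('n, 'k) mpoly set set" where
  "Ass I = {P. primeideal P mpoly_ring \<and> (\<exists>f. colon_elem I f = P)}"

definition alpha :: "('n::finite, 'k::field) mpoly set \<Rightarrow> nat" where
  "alpha I = (LEAST d. \<exists>f\<in>I - {0}. f \<in> graded_part d)"

definition c_number :: "('n::finite, 'k::field) mpoly set \<Rightarrow> nat" where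
  "c_number I = Max (alpha ` Ass I)"

definition v_local ::
    "('n::finite, 'k::field) mpoly set \<Rightarrow> ('n, 'k) mpoly set \<Rightarrow> nat" where
  "v_local P I = (LEAST d. \<exists>f\<in>graded_part d. colon_elem I f = P)"

definition v_number :: "('n::finite, 'k::field) mpoly set \<Rightarrow> nat" where
  "v_number I = (LEAST d. \<exists>f\<in>graded_part d. \<exists>P\<in>Ass I. colon_elem I f = P)"

end

theory Submission
  imports Defs "HOL-Computational_Algebra.Primes"
begin

text \<open>
  Write \<open>d = alpha I\<close>; since \<open>I\<close> is equigenerated, \<open>I\<^sup>k\<close> is generated in the single degree \<open>d k\<close>
  (\<open>ideal_power_equigenerated\<close>), so it has no nonzero homogeneous element of smaller degree.
  
  Lower bound (\<open>degree_witness_lower_bound\<close>).  If \<open>(I\<^sup>k : f) = P\<close> with \<open>f\<close> homogeneous, and \<open>h\<close> is a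
  nonzero homogeneous element of \<open>P\<close> of least degree, then \<open>h f\<close> is a nonzero element of \<open>I\<^sup>k\<close>.
  Hence \<open>deg f + alpha P \<ge> d k\<close>.
  
  Upper bound (\<open>witness_next_power\<close>).  Strong persistence gives
  \<open>(I\<^sup>k\<^sup>+\<^sup>1 : f I) = ((I\<^sup>k\<^sup>+\<^sup>1 : I) : f) = (I\<^sup>k : f) = P\<close>.  With finitely many generators \<open>h\<^sub>1, \<dots>, h\<^sub>r\<close>
  of \<open>I\<close> in degree \<open>d\<close>, the left side is the intersection of the \<open>(I\<^sup>k\<^sup>+\<^sup>1 : f h\<^sub>i)\<close>; as \<open>P\<close> is prime it
  equals one of them.  So passing from \<open>k\<close> to \<open>k + 1\<close> costs at most \<open>d\<close> in the degree of the witness.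
  The hypothesis on \<open>v_local P I\<close> says that the lower bound is attained at \<open>k = 1\<close>, hence it is
  attained at every \<open>k\<close>.
  
  For the v-number, suppose \<open>v_number I = alpha I - c_number I\<close>.  The lower bound forces a prime \<open>P\<close>
  that attains \<open>v_number I\<close> to have \<open>alpha P = c_number I\<close>, and the first part bounds \<open>v_number (I\<^sup>k)\<close> from above.  For the
  reverse inequality, powers of \<open>I\<close> may have associated primes \<open>Q\<close> that are not associated to \<open>I\<close>.
  But \<open>Q \<supseteq> I\<close>, so \<open>Q\<close> contains an associated prime \<open>P'\<close> of \<open>I\<close>
  (\<open>prime_contains_associated_prime\<close>), and \<open>alpha Q \<le> alpha P' \<le> c_number I\<close>.  The maximum
  that defines \<open>c_number I\<close> is over a finite set because \<open>P \<supseteq> I\<close> gives \<open>alpha P \<le> alpha I\<close>.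
  
  Two facts from commutative algebra are developed on the way: the maximal condition on ideals of the
  polynomial ring (\<open>maximal_ideal_in_family\<close>), and the existence of homogeneous witnesses
  for the associated primes of a graded ideal (\<open>homogeneous_witness\<close>).
\<close>

section \<open>Ideals of a commutative ring given by a type\<close>

lemma ideal_type_iff:
  "ideal I (ring_of_type_algebra :: 'a::comm_ring_1 ring) \<longleftrightarrow>
     0 \<in> I \<and> (\<forall>a\<in>I. \<forall>b\<in>I. a + b \<in> I) \<and> (\<forall>a. \<forall>b\<in>I. a * b \<in> I)"
  (is "ideal I ?R \<longleftrightarrow> ?closed")
proof
  assume I: "ideal I ?R"
  interpret ideal I ?R by (rule I)
  show ?closed
    using additive_subgroup.zero_closed[OF is_additive_subgroup]
      additive_subgroup.a_closed[OF is_additive_subgroup] I_l_closed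
    by (simp add: ring_of_type_algebra_def)
next
  assume c: ?closed
  interpret R: cring ?R by (rule cring_from_type_algebra)
  have minus: "\<ominus>\<^bsub>?R\<^esub> a = - a" for a :: 'a
    by (rule R.minus_equality) (auto simp: ring_of_type_algebra_def)
  show "ideal I ?R"
  proof (rule idealI)
    show "ring ?R" by (rule ring_from_type_algebra)
    have "- a \<in> I" if "a \<in> I" for a
      using c that by (metis mult_minus1)
    then show "subgroup I (add_monoid ?R)"
      using c minus unfolding subgroup_def a_inv_def[symmetric]
      by (auto simp: ring_of_type_algebra_def)
  next
    fix a x assume "a \<in> I" "x \<in> carrier ?R"
    have "x * a \<in> I" using c \<open>a \<in> I\<close> by blast
    then show "x \<otimes>\<^bsub>?R\<^esub> a \<in> I" "a \<otimes>\<^bsub>?R\<^esub> x \<in> I"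
      by (simp_all add: ring_of_type_algebra_def mult.commute)
  qed
qed

lemma primeideal_type_iff:
  "primeideal P (ring_of_type_algebra :: 'a::comm_ring_1 ring) \<longleftrightarrow>
     ideal P ring_of_type_algebra \<and> 1 \<notin> P \<and> (\<forall>a b. a * b \<in> P \<longrightarrow> a \<in> P \<or> b \<in> P)"
  (is "primeideal P ?R \<longleftrightarrow> _")
proof -
  interpret R: cring ?R by (rule cring_from_type_algebra)
  have one: "P = UNIV \<longleftrightarrow> 1 \<in> P" if "ideal P ?R"
  proof -
    from that have "a \<in> P" if "1 \<in> P" for a
      using that unfolding ideal_type_iff by (metis mult.right_neutral)
    then show ?thesis by auto
  qed
  show ?thesis
    using one R.cring_axioms
    by (auto simp: primeideal_def primeideal_axioms_def ring_of_type_algebra_def)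
qed

context
  fixes I :: "'a::comm_ring_1 set"
  assumes I: "ideal I ring_of_type_algebra"
begin

lemma ideal_zero: "0 \<in> I"
  and ideal_add: "a \<in> I \<Longrightarrow> b \<in> I \<Longrightarrow> a + b \<in> I"
  and ideal_mult: "b \<in> I \<Longrightarrow> a * b \<in> I"
  using I by (auto simp: ideal_type_iff)

lemma ideal_mult2: "a \<in> I \<Longrightarrow> a * b \<in> I"
  using ideal_mult[of a b] by (simp add: mult.commute)

lemma ideal_diff: "a \<in> I \<Longrightarrow> b \<in> I \<Longrightarrow> a - b \<in> I"
  using ideal_add[of a "(-1) * b"] ideal_mult[of b "-1"] by simp

lemma ideal_sum: "(\<And>i. i \<in> A \<Longrightarrow> f i \<in> I) \<Longrightarrow> sum f A \<in> I"
  by (induction A rule: infinite_finite_induct) (auto simp: ideal_zero ideal_add)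

lemma quotient_ideal: "ideal {g. \<forall>h\<in>H. g * h \<in> I} ring_of_type_algebra"
  by (auto simp: ideal_type_iff ideal_zero ideal_add ideal_mult distrib_right mult.assoc)

end

lemma Idl_ideal: "ideal (Idl\<^bsub>ring_of_type_algebra\<^esub> G) (ring_of_type_algebra :: 'a::comm_ring_1 ring)"
  and Idl_superset: "G \<subseteq> Idl\<^bsub>ring_of_type_algebra :: 'a ring\<^esub> G"
proof -
  interpret R: cring "ring_of_type_algebra :: 'a ring" by (rule cring_from_type_algebra)
  have "G \<subseteq> carrier ring_of_type_algebra" by (simp add: ring_of_type_algebra_def)
  then show "ideal (Idl\<^bsub>ring_of_type_algebra\<^esub> G) (ring_of_type_algebra :: 'a ring)"
    and "G \<subseteq> Idl\<^bsub>ring_of_type_algebra\<^esub> G"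
    by (auto intro: R.genideal_ideal R.genideal_self[THEN subsetD])
qed

lemma Idl_least:
  assumes "ideal I (ring_of_type_algebra :: 'a::comm_ring_1 ring)" "G \<subseteq> I"
  shows "Idl\<^bsub>ring_of_type_algebra\<^esub> G \<subseteq> I"
  using assms by (auto simp: genideal_def)

lemma prime_power_mem:
  assumes "primeideal P (ring_of_type_algebra :: 'a::comm_ring_1 ring)" "a ^ k \<in> P"
  shows "a \<in> P"
  using assms(2) by (induction k) (use assms(1) in \<open>auto simp: primeideal_type_iff\<close>)

lemma prime_prod_mem:
  assumes P: "primeideal P (ring_of_type_algebra :: 'a::comm_ring_1 ring)"
    and "finite A" "prod f A \<in> P"
  shows "\<exists>a\<in>A. f a \<in> P"
  using assms(2,3) by (induction A) (use P in \<open>auto simp: primeideal_type_iff\<close>)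

text \<open>
  A prime that is a finite intersection of the ideals \<open>(J : x)\<close> is one of them: otherwise
  each \<open>(J : x)\<close> contains some \<open>g x\<close> outside the prime, and the product of the \<open>g x\<close> lies in
  all of them.
\<close>

lemma prime_eq_quotient_single:
  assumes J: "ideal J (ring_of_type_algebra :: 'a::comm_ring_1 ring)"
    and P: "primeideal P ring_of_type_algebra"
    and A: "finite A" and PA: "P = {g. \<forall>x\<in>A. g * x \<in> J}"
  shows "\<exists>x\<in>A. P = {g. g * x \<in> J}"
proof -
  have "\<exists>x\<in>A. {g. g * x \<in> J} \<subseteq> P"
  proof (rule ccontr)
    assume "\<not> ?thesis"
    then have "\<forall>x\<in>A. \<exists>g. g * x \<in> J \<and> g \<notin> P" by auto
    then obtain g where g: "\<And>x. x \<in> A \<Longrightarrow> g x * x \<in> J \<and> g x \<notin> P" by metis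
    have "prod g A * x \<in> J" if "x \<in> A" for x
    proof -
      have "prod g A * x = prod g (A - {x}) * (g x * x)"
        by (simp add: prod.remove[OF A that] ac_simps)
      then show ?thesis using g[OF that] ideal_mult[OF J] by simp
    qed
    then have "prod g A \<in> P" by (simp add: PA)
    then show False using prime_prod_mem[OF P A] g by blast
  qed
  then show ?thesis using PA by blast
qed

section \<open>Dickson's lemma\<close>

lemma nat_seq_mono_subseq:
  fixes s :: "nat \<Rightarrow> nat"
  shows "\<exists>\<phi> :: nat \<Rightarrow> nat. strict_mono \<phi> \<and> mono (\<lambda>n. s (\<phi> n))"
proof -
  obtain f where f: "strict_mono f" "monoseq (\<lambda>n. s (f n))"
    using seq_monosub by blast
  show ?thesis
  proof (cases "incseq (\<lambda>n. s (f n))")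
    case False
    then have dec: "decseq (\<lambda>n. s (f n))" using f(2) by (auto simp: monoseq_iff)
    \<comment> \<open>A decreasing sequence of naturals is constant once it has reached its minimum.\<close>
    define N where "N = (ARG_MIN (\<lambda>n. s (f n)) n. True)"
    have N: "s (f N) \<le> s (f n)" for n
      unfolding N_def by (rule arg_min_nat_le) simp
    have "s (f (N + n)) = s (f N)" for n
      using decseqD[OF dec, of N "N + n"] N[of "N + n"] by simp
    then have "mono (\<lambda>n. s (f (N + n)))" by (simp add: mono_def)
    moreover have "strict_mono (\<lambda>n. f (N + n))"
      using f(1) by (simp add: strict_mono_def)
    ultimately show ?thesis by (intro exI[of _ "\<lambda>n. f (N + n)"]) simp
  qed (use f in blast)
qed

text \<open>
  Refining a subsequence keeps the coordinates that are already monotone, so the coordinates can be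
  treated one after the other.
\<close>

lemma dickson_subseq:
  fixes s :: "nat \<Rightarrow> 'i \<Rightarrow> nat"
  assumes "finite V"
  shows "\<exists>\<phi> :: nat \<Rightarrow> nat. strict_mono \<phi> \<and> (\<forall>v\<in>V. mono (\<lambda>n. s (\<phi> n) v))"
  using assms
proof (induction V)
  case empty
  show ?case using strict_mono_id by blast
next
  case (insert v V)
  then obtain \<phi> :: "nat \<Rightarrow> nat" where \<phi>: "strict_mono \<phi>" "\<forall>u\<in>V. mono (\<lambda>n. s (\<phi> n) u)" by blast
  obtain \<psi> :: "nat \<Rightarrow> nat" where \<psi>: "strict_mono \<psi>" "mono (\<lambda>n. s (\<phi> (\<psi> n)) v)"
    using nat_seq_mono_subseq[of "\<lambda>n. s (\<phi> n) v"] by blast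
  have "mono (\<lambda>n. s ((\<phi> \<circ> \<psi>) n) u)" if "u \<in> V" for u
    using \<phi>(2) that strict_mono_mono[OF \<psi>(1)] by (auto simp: mono_def)
  moreover have "strict_mono (\<phi> \<circ> \<psi>)" using \<phi>(1) \<psi>(1) by (rule strict_mono_o)
  ultimately show ?case using \<psi>(2) by (intro exI[of _ "\<phi> \<circ> \<psi>"]) (simp add: o_def)
qed

lemma dickson:
  fixes m :: "nat \<Rightarrow> ('n::finite \<Rightarrow>\<^sub>0 nat)"
  shows "\<exists>i j a. i < j \<and> m j = a + m i"
proof -
  obtain \<phi> :: "nat \<Rightarrow> nat" where \<phi>: "strict_mono \<phi>"
      "\<And>v. mono (\<lambda>n. Poly_Mapping.lookup (m (\<phi> n)) v)"
    using dickson_subseq[of UNIV "\<lambda>n. Poly_Mapping.lookup (m n)"] by auto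
  have "m (\<phi> 1) = (m (\<phi> 1) - m (\<phi> 0)) + m (\<phi> 0)"
    using monoD[OF \<phi>(2), of 0 1]
    by (intro poly_mapping_eqI) (simp add: lookup_add lookup_minus)
  moreover have "\<phi> 0 < \<phi> 1" using \<phi>(1) by (simp add: strict_mono_def)
  ultimately show ?thesis
    by (intro exI[of _ "\<phi> 0"] exI[of _ "\<phi> 1"] exI[of _ "m (\<phi> 1) - m (\<phi> 0)"] conjI)
qed

section \<open>Leading monomials and the ascending chain condition\<close>

text \<open>
  A monomial order is obtained by sending the variables to distinct primes and comparing the images of
  monomials as natural numbers.  The resulting map is injective and multiplicative, so the order is
  total, well-founded and compatible with multiplication of monomials.
\<close>

definition variable_prime :: "'n::finite \<Rightarrow> nat" where
  "variable_prime = (SOME p. inj p \<and> (\<forall>i. prime (p i)))"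

definition godel_number :: "('n::finite \<Rightarrow>\<^sub>0 nat) \<Rightarrow> nat" where
  "godel_number m = (\<Prod>i\<in>UNIV. variable_prime i ^ Poly_Mapping.lookup m i)"

lemma variable_prime:
  "inj (variable_prime :: 'n::finite \<Rightarrow> nat)" "prime (variable_prime (i :: 'n))"
proof -
  obtain B :: "nat set" where "B \<subseteq> {p. prime p}" "finite B" "card B = card (UNIV :: 'n set)"
    using infinite_arbitrarily_large[OF primes_infinite] by metis
  moreover from this obtain p where "bij_betw p (UNIV :: 'n set) B"
    using finite_same_card_bij[of "UNIV :: 'n set" B] by auto
  ultimately have "\<exists>p :: 'n \<Rightarrow> nat. inj p \<and> (\<forall>i. prime (p i))"
    by (auto simp: bij_betw_def intro!: exI[of _ p])
  then have "inj (variable_prime :: 'n \<Rightarrow> nat) \<and> (\<forall>i :: 'n. prime (variable_prime i))"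
    unfolding variable_prime_def by (rule someI_ex)
  then show "inj (variable_prime :: 'n \<Rightarrow> nat)" "prime (variable_prime i)" by auto
qed

lemma godel_number_add: "godel_number (a + b) = godel_number a * godel_number b"
  by (simp add: godel_number_def lookup_add power_add prod.distrib)

lemma godel_number_pos: "godel_number a > 0"
  by (auto simp: godel_number_def variable_prime(2) prime_gt_0_nat intro!: prod_pos)

lemma godel_number_eqD:
  fixes a b :: "'n::finite \<Rightarrow>\<^sub>0 nat"
  assumes "godel_number a = godel_number b"
  shows "a = b"
proof (rule poly_mapping_eqI)
  fix i
  let ?p = "variable_prime :: 'n \<Rightarrow> nat"
  have "multiplicity (?p i) (godel_number m) = Poly_Mapping.lookup m i" for m
  proof -
    let ?e = "\<lambda>q. Poly_Mapping.lookup m (inv_into UNIV ?p q)"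
    have "godel_number m = (\<Prod>q\<in>range ?p. q ^ ?e q)"
      by (simp add: godel_number_def prod.reindex variable_prime(1))
    also have "multiplicity (?p i) \<dots> = ?e (?p i)"
      by (subst multiplicity_prod_prime_powers) (auto simp: variable_prime(2))
    finally show ?thesis by (simp add: variable_prime(1))
  qed
  then show "Poly_Mapping.lookup a i = Poly_Mapping.lookup b i"
    using assms by metis
qed

text \<open>
  The number of the leading monomial.  The inserted \<open>0\<close>, which is no monomial's number,
  makes the zero polynomial smaller than all others.
\<close>

definition leading_number :: "('n::finite, 'k::field) mpoly \<Rightarrow> nat" where
  "leading_number f = Max (insert 0 (godel_number ` Poly_Mapping.keys f))"

lemma leading_number_less_iff:
  "0 < N \<Longrightarrow> leading_number f < N \<longleftrightarrow> (\<forall>m\<in>Poly_Mapping.keys f. godel_number m < N)"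
  by (simp add: leading_number_def)

lemma leading_term:
  fixes f :: "('n::finite, 'k::field) mpoly"
  assumes "f \<noteq> 0"
  obtains m c g where "f = Poly_Mapping.single m c + g" "c \<noteq> 0"
    "leading_number f = godel_number m" "leading_number g < godel_number m"
proof -
  have "godel_number ` Poly_Mapping.keys f \<noteq> {}" using assms by simp
  then have "Max (godel_number ` Poly_Mapping.keys f) \<in> godel_number ` Poly_Mapping.keys f"
    by (intro Max_in) auto
  then obtain m where m: "m \<in> Poly_Mapping.keys f"
      "Max (godel_number ` Poly_Mapping.keys f) = godel_number m" by auto
  define g where "g = f - Poly_Mapping.single m (Poly_Mapping.lookup f m)"
  have "godel_number q < godel_number m" if q: "q \<in> Poly_Mapping.keys g" for q
  proof -
    have "q \<noteq> m" "q \<in> Poly_Mapping.keys f"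
      using q by (auto simp: g_def in_keys_iff lookup_minus lookup_single when_def split: if_splits)
    moreover from this have "godel_number q \<le> godel_number m"
      using m(2) by (metis Max_ge finite_imageI finite_keys imageI)
    ultimately show ?thesis using godel_number_eqD le_neq_implies_less by blast
  qed
  then have "leading_number g < godel_number m"
    by (simp add: leading_number_less_iff godel_number_pos)
  moreover have "leading_number f = godel_number m"
    using m \<open>godel_number ` Poly_Mapping.keys f \<noteq> {}\<close>
    by (simp add: leading_number_def Max_insert)
  ultimately show ?thesis
    using that[of m "Poly_Mapping.lookup f m" g] m(1) by (simp add: g_def in_keys_iff)
qed

text \<open>
  Here \<open>g\<close> is meant to be the tail of a polynomial with leading monomial numbered \<open>B\<close>: its
  multiples stay strictly below the leading monomial of the full product.
\<close>

lemma leading_number_mult_less: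
  assumes "leading_number f \<le> A" "leading_number g < B" "0 < A"
  shows "leading_number (f * g) < A * B"
proof -
  have "godel_number q < A * B" if q: "q \<in> Poly_Mapping.keys (f * g)" for q
  proof -
    obtain a b where ab: "q = a + b" "a \<in> Poly_Mapping.keys f" "b \<in> Poly_Mapping.keys g"
      using keys_mult[of f g] q by blast
    then have "godel_number a \<le> A" "godel_number b < B"
      using assms by (auto simp: leading_number_def)
    then have "godel_number a * godel_number b < A * B"
      using \<open>0 < A\<close> by (meson le_less_trans mult_le_mono1 mult_less_cancel1)
    then show ?thesis by (simp add: ab(1) godel_number_add)
  qed
  moreover have "0 < A * B" using assms by simp
  ultimately show ?thesis by (simp add: leading_number_less_iff)
qed

text \<open>
  The leading terms multiply to a term that no other product of terms can cancel.
\<close>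

lemma mpoly_mult_nonzero:
  fixes f g :: "('n::finite, 'k::field) mpoly"
  assumes "f \<noteq> 0" "g \<noteq> 0"
  shows "f * g \<noteq> 0"
proof
  assume 0: "f * g = 0"
  obtain m c f' where f: "f = Poly_Mapping.single m c + f'" "c \<noteq> 0"
    "leading_number f = godel_number m" "leading_number f' < godel_number m"
    using leading_term[OF assms(1)] .
  obtain n d g' where g: "g = Poly_Mapping.single n d + g'" "d \<noteq> 0"
    "leading_number g = godel_number n" "leading_number g' < godel_number n"
    using leading_term[OF assms(2)] .
  have "leading_number (f * g') < godel_number m * godel_number n"
    using f g godel_number_pos by (intro leading_number_mult_less) auto
  moreover have "leading_number (Poly_Mapping.single n d * f') < godel_number n * godel_number m"
    using f g godel_number_pos
    by (intro leading_number_mult_less) (auto simp: leading_number_def)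
  ultimately have "m + n \<notin> Poly_Mapping.keys (f * g')"
      "m + n \<notin> Poly_Mapping.keys (Poly_Mapping.single n d * f')"
    by (auto simp: leading_number_def godel_number_add mult.commute)
  then have "Poly_Mapping.lookup (f * g') (m + n) = 0"
      "Poly_Mapping.lookup (Poly_Mapping.single n d * f') (m + n) = 0"
    by (simp_all add: in_keys_iff)
  moreover have "f * g = Poly_Mapping.single (m + n) (c * d) + Poly_Mapping.single n d * f' + f * g'"
    by (simp add: f(1) g(1) algebra_simps mult_single)
  ultimately have "Poly_Mapping.lookup (f * g) (m + n) = c * d"
    by (simp add: lookup_add)
  then show False using 0 f(2) g(2) by simp
qed

text \<open>
  Choose \<open>f i\<close> in \<open>J (Suc i) - J i\<close> with minimal leading monomial.  By Dickson's lemma the leading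
  monomial of some \<open>f i\<close> divides that of a later \<open>f j\<close>.  Subtracting the multiple of \<open>f i\<close> that
  cancels the leading term of \<open>f j\<close> stays in \<open>J (Suc j) - J j\<close>, because \<open>f i\<close> lies in \<open>J j\<close>, and
  has a smaller leading monomial: a contradiction.
\<close>

lemma no_strict_ideal_chain:
  fixes J :: "nat \<Rightarrow> ('n::finite, 'k::field) mpoly set"
  assumes J: "\<And>i. ideal (J i) mpoly_ring" and strict: "\<And>i. J i \<subset> J (Suc i)"
  shows False
proof -
  define f where "f i = (ARG_MIN leading_number h. h \<in> J (Suc i) - J i)" for i
  have f: "f i \<in> J (Suc i) - J i" for i
  proof -
    obtain h where "h \<in> J (Suc i) - J i" using strict[of i] by blast
    then show ?thesis unfolding f_def by (rule arg_min_natI)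
  qed
  have f_min: "leading_number (f i) \<le> leading_number h" if "h \<in> J (Suc i) - J i" for i h
    unfolding f_def using that by (rule arg_min_nat_le)
  have "f i \<noteq> 0" for i using f[of i] ideal_zero[OF J] by auto
  then have "\<exists>m c g. f i = Poly_Mapping.single m c + g \<and> c \<noteq> 0 \<and>
      leading_number (f i) = godel_number m \<and> leading_number g < godel_number m" for i
    by (metis leading_term)
  then obtain m c g where mcg: "\<And>i. f i = Poly_Mapping.single (m i) (c i) + g i"
    "\<And>i. c i \<noteq> 0" "\<And>i. leading_number (f i) = godel_number (m i)"
    "\<And>i. leading_number (g i) < godel_number (m i)" by metis
  obtain i j a where ij: "i < j" "m j = a + m i" using dickson by blast
  \<comment> \<open>\<open>q f\<^sub>i\<close> has the same leading term as \<open>f\<^sub>j\<close>.\<close>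
  define q where "q = Poly_Mapping.single a (c j / c i)"
  have "incseq J" using strict by (intro incseq_SucI) auto
  then have "f i \<in> J j" using f[of i] ij(1) by (meson DiffD1 Suc_leI incseqD subsetD)
  then have qf: "q * f i \<in> J j" by (rule ideal_mult[OF J])
  moreover have "J j \<subseteq> J (Suc j)" using strict by auto
  ultimately have "f j - q * f i \<in> J (Suc j) - J j"
    using f[of j] ideal_diff[OF J, of "f j" "Suc j" "q * f i"]
      ideal_add[OF J, of "f j - q * f i" j "q * f i"] by auto
  then have "leading_number (f j) \<le> leading_number (f j - q * f i)" by (rule f_min)
  moreover have "f j - q * f i = g j - q * g i"
    using mcg(2)[of i] by (subst (1 2) mcg(1)) (simp add: q_def ij(2) algebra_simps mult_single)
  moreover have "leading_number (g j - q * g i) < godel_number (m j)"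
  proof -
    have "leading_number (q * g i) < godel_number a * godel_number (m i)"
      using mcg(4)[of i] godel_number_pos
      by (intro leading_number_mult_less) (auto simp: q_def leading_number_def)
    then have "leading_number (q * g i) < godel_number (m j)"
      by (simp add: ij(2) godel_number_add)
    then show ?thesis
      using mcg(4)[of j] keys_diff[of "g j" "q * g i"]
      by (auto simp: leading_number_less_iff[OF godel_number_pos])
  qed
  ultimately show False by (simp add: mcg(3))
qed

lemma maximal_set_if_no_chain:
  fixes F :: "'a set set"
  assumes chain: "\<And>J. (\<And>i :: nat. J i \<in> F) \<Longrightarrow> (\<And>i. J i \<subset> J (Suc i)) \<Longrightarrow> False" and "J \<in> F"
  shows "\<exists>M\<in>F. \<forall>L\<in>F. M \<subseteq> L \<longrightarrow> L = M"
proof (rule ccontr)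
  assume no: "\<not> ?thesis"
  have "\<exists>L. L \<in> F \<and> M \<subset> L" if "M \<in> F" for M
    using no that by blast
  then have "\<exists>f. \<forall>n. f n \<in> F \<and> f n \<subset> f (Suc n)"
    using \<open>J \<in> F\<close> by (intro dependent_nat_choice) auto
  then show False using chain by blast
qed
lemma maximal_ideal_in_family:
  fixes F :: "('n::finite, 'k::field) mpoly set set"
  assumes "J \<in> F" and F: "\<And>J. J \<in> F \<Longrightarrow> ideal J mpoly_ring"
  shows "\<exists>M\<in>F. \<forall>L\<in>F. M \<subseteq> L \<longrightarrow> L = M"
proof (rule maximal_set_if_no_chain[OF _ \<open>J \<in> F\<close>])
  fix f :: "nat \<Rightarrow> ('n, 'k) mpoly set"
  assume "\<And>i. f i \<in> F" "\<And>i. f i \<subset> f (Suc i)"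
  then show False by (intro no_strict_ideal_chain[of f] F)
qed

section \<open>Homogeneous components\<close>

definition component :: "nat \<Rightarrow> ('n::finite, 'k::field) mpoly \<Rightarrow> ('n, 'k) mpoly" where
  "component d f = Poly_Mapping.mapp (\<lambda>m c. c when mdeg m = d) f"

lemma lookup_component:
  "Poly_Mapping.lookup (component d f) m = (Poly_Mapping.lookup f m when mdeg m = d)"
  by (auto simp: component_def lookup_mapp in_keys_iff when_def)

lemma component_add: "component d (f + g) = component d f + component d g"
  by (intro poly_mapping_eqI) (simp add: lookup_component lookup_add when_add_distrib)

lemma component_zero: "component d 0 = 0"
  by (intro poly_mapping_eqI) (simp add: lookup_component)

lemma component_diff: "component d (f - g) = component d f - component d g"
  by (intro poly_mapping_eqI) (simp add: lookup_component lookup_minus when_diff_distrib)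

lemma component_sum: "component d (sum f A) = (\<Sum>i\<in>A. component d (f i))"
  by (induction A rule: infinite_finite_induct) (simp_all add: component_add component_zero)

lemma component_in_graded_part: "component d f \<in> graded_part d"
  by (auto simp: graded_part_def in_keys_iff lookup_component)

lemma component_of_homogeneous:
  "f \<in> graded_part e \<Longrightarrow> component d f = (if d = e then f else 0)"
  by (intro poly_mapping_eqI)
     (auto simp: graded_part_def lookup_component in_keys_iff when_def)

text \<open>
  The bound is left open above, so that two polynomials can be expanded with a common one.
\<close>

lemma sum_components: "\<exists>N. \<forall>M\<ge>N. f = (\<Sum>e\<le>M. component e f)"
proof (intro exI allI impI poly_mapping_eqI)
  fix M m
  assume M: "Max (insert 0 (mdeg ` Poly_Mapping.keys f)) \<le> M"
  have "(\<Sum>e\<le>M. Poly_Mapping.lookup f m when mdeg m = e) =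
      (Poly_Mapping.lookup f m when mdeg m \<le> M)"
    by (simp add: when_def)
  also have "\<dots> = Poly_Mapping.lookup f m"
    using M by (auto simp: when_def in_keys_iff)
  finally show "Poly_Mapping.lookup f m = Poly_Mapping.lookup (\<Sum>e\<le>M. component e f) m"
    by (simp add: lookup_sum lookup_component)
qed

lemma mdeg_add: "mdeg (a + b) = mdeg a + mdeg b"
  by (simp add: mdeg_def lookup_add sum.distrib)

lemma graded_part_mult:
  "f \<in> graded_part a \<Longrightarrow> g \<in> graded_part b \<Longrightarrow> f * g \<in> graded_part (a + b)"
  using keys_mult[of f g] by (fastforce simp: graded_part_def mdeg_add)

lemma component_mult:
  "component d (f * g) = (\<Sum>e\<le>d. component e f * component (d - e) g)"
proof -
  obtain A B where A: "\<And>M. A \<le> M \<Longrightarrow> f = (\<Sum>e\<le>M. component e f)"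
    and B: "\<And>M. B \<le> M \<Longrightarrow> g = (\<Sum>e\<le>M. component e g)"
    using sum_components[of f] sum_components[of g] by auto
  define M where "M = max d (max A B)"
  have "f * g = (\<Sum>i\<le>M. \<Sum>j\<le>M. component i f * component j g)"
    by (subst A[of M], simp add: M_def, subst B[of M], simp add: M_def)
       (simp add: sum_product)
  then have "component d (f * g) =
      (\<Sum>i\<le>M. \<Sum>j\<le>M. component d (component i f * component j g))"
    by (simp add: component_sum)
  also have "\<dots> = (\<Sum>i\<le>M. if i \<le> d then component i f * component (d - i) g else 0)"
  proof (rule sum.cong)
    fix i assume "i \<in> {..M}"
    have "component d (component i f * component j g) =
        (if d = i + j then component i f * component j g else 0)" for j
      by (intro component_of_homogeneous graded_part_mult component_in_graded_part)
    moreover have "d = i + j \<longleftrightarrow> i \<le> d \<and> j = d - i" for j by auto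
    moreover have "d - i \<le> M" by (simp add: M_def)
    ultimately show "(\<Sum>j\<le>M. component d (component i f * component j g)) =
        (if i \<le> d then component i f * component (d - i) g else 0)"
      by simp
  qed simp
  also have "\<dots> = (\<Sum>i\<in>{i \<in> {..M}. i \<le> d}. component i f * component (d - i) g)"
    by (rule sum.inter_filter[symmetric]) simp
  also have "{i \<in> {..M}. i \<le> d} = {..d}" by (auto simp: M_def)
  finally show ?thesis .
qed

text \<open>
  The polynomials all of whose components lie in \<open>I\<close> form an ideal, by the convolution formula
  for components, and this ideal contains the homogeneous generators of \<open>I\<close>.
\<close>

lemma graded_ideal_component:
  assumes "graded_ideal I" "f \<in> I"
  shows "component d f \<in> I"
proof -
  obtain G where G: "G \<subseteq> (\<Union>d. graded_part d)" "I = Idl\<^bsub>mpoly_ring\<^esub> G"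
    using assms(1) by (auto simp: graded_ideal_def)
  have I: "ideal I mpoly_ring" by (simp add: G(2) Idl_ideal)
  have "ideal {h. \<forall>d. component d h \<in> I} mpoly_ring"
    by (auto simp: ideal_type_iff component_zero component_add component_mult
        intro!: ideal_zero[OF I] ideal_add[OF I] ideal_sum[OF I] ideal_mult[OF I])
  moreover have "G \<subseteq> {h. \<forall>d. component d h \<in> I}"
  proof clarify
    fix h d assume h: "h \<in> G"
    then obtain e where "h \<in> graded_part e" using G(1) by auto
    moreover have "h \<in> I" using h Idl_superset G(2) by blast
    ultimately show "component d h \<in> I"
      by (simp add: component_of_homogeneous ideal_zero[OF I])
  qed
  ultimately have "I \<subseteq> {h. \<forall>d. component d h \<in> I}"
    unfolding G(2) by (rule Idl_least)
  then show ?thesis using assms(2) by blast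
qed

lemma graded_ideal_is_ideal: "graded_ideal I \<Longrightarrow> ideal I mpoly_ring"
  by (auto simp: graded_ideal_def Idl_ideal)

lemma equigenerated_graded_ideal: "G \<subseteq> graded_part d \<Longrightarrow> graded_ideal (Idl\<^bsub>mpoly_ring\<^esub> G)"
  by (auto simp: graded_ideal_def)

section \<open>Associated primes of graded ideals\<close>

lemma colon_elem_eq:
  assumes J: "ideal J mpoly_ring"
  shows "colon_elem J f = {g. g * f \<in> J}"
proof -
  have "\<forall>h\<in>Idl\<^bsub>mpoly_ring\<^esub> {f}. g * h \<in> J" if "g * f \<in> J" for g
  proof -
    have "ideal {h. g * h \<in> J} mpoly_ring"
      using quotient_ideal[OF J, of "{g}"] by (simp add: mult.commute)
    then show ?thesis using Idl_least[of _ "{f}"] that by blast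
  qed
  then show ?thesis using Idl_superset[of "{f}"] by (auto simp: colon_elem_def colon_def)
qed

lemma quotient_elem_ideal: "ideal J mpoly_ring \<Longrightarrow> ideal {g. g * f \<in> J} mpoly_ring"
  using quotient_ideal[of J "{f}"] by simp

text \<open>
  Let \<open>h\<close> be the lowest component of \<open>g\<close>, in degree \<open>r\<close>.  In degree \<open>r + s\<close>, the product \<open>g f\<close> has
  the component \<open>h f\<^sub>s\<close> plus multiples of components of \<open>f\<close> of degree below \<open>s\<close>.  Inductively,
  \<open>h\<^sup>s\<close> sends the latter into \<open>J\<close>, so \<open>h\<^sup>s\<^sup>+\<^sup>1\<close> sends \<open>f\<^sub>s\<close> into \<open>J\<close>.  A high power of \<open>h\<close> therefore
  sends \<open>f\<close> into \<open>J\<close>, that is, it lies in \<open>P\<close>, and \<open>P\<close> is prime.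
\<close>

lemma lowest_component_mem_prime:
  assumes J: "graded_ideal J" and P: "primeideal P mpoly_ring" "P = {g. g * f \<in> J}"
    and g: "g \<in> P" and low: "\<And>e. e < r \<Longrightarrow> component e g = 0"
  shows "component r g \<in> P"
proof -
  note I = graded_ideal_is_ideal[OF J]
  let ?h = "component r g"
  have kill: "?h ^ s * component e f \<in> J" if "e < s" for e s
    using that
  proof (induction s arbitrary: e)
    case (Suc s)
    show ?case
    proof (cases "e = s")
      case False
      then show ?thesis using Suc ideal_mult[OF I] by (simp add: mult.assoc)
    next
      case True
      have "component (r + s) (g * f) \<in> J"
        using J g P(2) by (auto intro: graded_ideal_component)
      then have "?h ^ s * component (r + s) (g * f) \<in> J" by (rule ideal_mult[OF I])
      moreover have "?h ^ s * component (r + s) (g * f) =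
          (\<Sum>i\<le>r + s. ?h ^ s * (component i g * component (r + s - i) f))"
        by (simp add: component_mult sum_distrib_left)
      moreover have "(\<Sum>i\<in>{..r + s} - {r}. ?h ^ s * (component i g * component (r + s - i) f)) \<in> J"
      proof (rule ideal_sum[OF I])
        fix i assume i: "i \<in> {..r + s} - {r}"
        show "?h ^ s * (component i g * component (r + s - i) f) \<in> J"
        proof (cases "i < r")
          case True
          then show ?thesis using low ideal_zero[OF I] by simp
        next
          case False
          then have "?h ^ s * component (r + s - i) f \<in> J" using i by (intro Suc.IH) auto
          then show ?thesis using ideal_mult[OF I, of _ "component i g"]
            by (simp add: mult.left_commute)
        qed
      qed
      ultimately have "?h ^ s * (?h * component s f) \<in> J"
        using ideal_diff[OF I] by (fastforce simp: sum.remove[of "{..r + s}" r])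
      then show ?thesis by (simp add: True ac_simps)
    qed
  qed simp
  obtain N where N: "f = (\<Sum>e\<le>N. component e f)" using sum_components by blast
  have "?h ^ Suc N * f = (\<Sum>e\<le>N. ?h ^ Suc N * component e f)"
    by (subst N) (simp only: sum_distrib_left)
  also have "\<dots> \<in> J" by (intro ideal_sum[OF I] kill) simp
  finally have "?h ^ Suc N \<in> P" using P(2) by blast
  then show ?thesis by (rule prime_power_mem[OF P(1)])
qed

text \<open>
  Once the components of degree below \<open>r\<close> are known to lie in \<open>P\<close>, they can be subtracted from \<open>g\<close>,
  and the component of degree \<open>r\<close> becomes the lowest one.
\<close>

lemma component_mem_prime:
  assumes J: "graded_ideal J" and P: "primeideal P mpoly_ring" "P = {g. g * f \<in> J}"
    and g: "g \<in> P"
  shows "component r g \<in> P"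
proof (induction r rule: less_induct)
  case (less r)
  have I: "ideal P mpoly_ring" using P(1) by (simp add: primeideal_type_iff)
  define g' where "g' = g - (\<Sum>e<r. component e g)"
  have comp: "component d g' = (if d < r then 0 else component d g)" for d
  proof -
    have "component d (\<Sum>e<r. component e g) = (\<Sum>e<r. if d = e then component e g else 0)"
      unfolding component_sum
      by (intro sum.cong component_of_homogeneous component_in_graded_part refl)
    then show ?thesis by (simp add: g'_def component_diff)
  qed
  have "g' \<in> P" unfolding g'_def using g less by (intro ideal_diff[OF I] ideal_sum[OF I]) auto
  then have "component r g' \<in> P"
    by (intro lowest_component_mem_prime[OF J P]) (simp_all add: comp)
  then show ?case by (simp add: comp)
qed

text \<open>
  As \<open>P\<close> is graded, \<open>P f \<subseteq> J\<close> implies \<open>P f\<^sub>e \<subseteq> J\<close> for every component of \<open>f\<close>.  So \<open>P\<close> is the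
  intersection of the finitely many \<open>(J : f\<^sub>e)\<close>, hence equal to one of them.
\<close>

lemma homogeneous_witness:
  assumes J: "graded_ideal J" and P: "P \<in> Ass J"
  obtains d f where "f \<in> graded_part d" "colon_elem J f = P"
proof -
  note I = graded_ideal_is_ideal[OF J]
  obtain f where f: "primeideal P mpoly_ring" "P = {g. g * f \<in> J}"
    using P by (auto simp: Ass_def colon_elem_eq[OF I])
  obtain N where N: "f = (\<Sum>e\<le>N. component e f)" using sum_components by blast
  have "P = {g. \<forall>x\<in>(\<lambda>e. component e f) ` {..N}. g * x \<in> J}"
  proof (intro equalityI subsetI CollectI ballI)
    fix g x assume g: "g \<in> P" and x: "x \<in> (\<lambda>e. component e f) ` {..N}"
    then obtain e where e: "x = component e f" by auto
    have "component d g * component e f \<in> J" for d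
    proof -
      have "component (d + e) (component d g * f) \<in> J"
        using component_mem_prime[OF J f g, of d] J f(2) by (auto intro: graded_ideal_component)
      moreover have "component (d + e) (component d g * f) =
          (\<Sum>i\<le>d + e. if i = d then component d g * component e f else 0)"
        unfolding component_mult
        by (intro sum.cong) (auto simp: component_of_homogeneous[OF component_in_graded_part])
      ultimately show ?thesis by simp
    qed
    moreover obtain M where M: "g = (\<Sum>d\<le>M. component d g)" using sum_components by blast
    ultimately have "(\<Sum>d\<le>M. component d g * component e f) \<in> J" by (intro ideal_sum[OF I])
    then show "g * x \<in> J" using M e by (metis sum_distrib_right)
  next
    fix g assume "g \<in> {g. \<forall>x\<in>(\<lambda>e. component e f) ` {..N}. g * x \<in> J}"
    then have "(\<Sum>e\<le>N. g * component e f) \<in> J" by (intro ideal_sum[OF I]) auto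
    then have "g * f \<in> J" using N by (metis sum_distrib_left)
    then show "g \<in> P" using f(2) by blast
  qed
  then obtain x where "x \<in> (\<lambda>e. component e f) ` {..N}" "P = {g. g * x \<in> J}"
    using prime_eq_quotient_single[OF I f(1), of "(\<lambda>e. component e f) ` {..N}"] by auto
  then show ?thesis using that component_in_graded_part by (auto simp: colon_elem_eq[OF I])
qed

section \<open>Consequences of the maximal condition\<close>

lemma quotient_elem_mono:
  assumes J: "ideal J mpoly_ring"
  shows "{g. g * f \<in> J} \<subseteq> {g. g * (a * f) \<in> J}"
proof clarify
  fix g assume "g * f \<in> J"
  then have "a * (g * f) \<in> J" by (rule ideal_mult[OF J])
  then show "g * (a * f) \<in> J" by (simp only: mult.left_commute)
qed

text \<open>
  A maximal ideal among the proper \<open>(J : f)\<close> is prime: if \<open>a\<close> is not in \<open>(J : f)\<close>, then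
  \<open>(J : a f)\<close> is still proper and contains \<open>(J : f)\<close>, so the two are equal.
\<close>

lemma ex_associated_prime:
  assumes J: "ideal J (mpoly_ring :: ('n::finite, 'k::field) mpoly ring)" and "1 \<notin> J"
  obtains f where "primeideal {g. g * f \<in> J} mpoly_ring"
proof -
  let ?F = "(\<lambda>f. {g. g * f \<in> J}) ` (- J)"
  have "{g. g * 1 \<in> J} \<in> ?F" using \<open>1 \<notin> J\<close> by blast
  moreover have "ideal M mpoly_ring" if "M \<in> ?F" for M
    using that quotient_elem_ideal[OF J] by auto
  ultimately have "\<exists>M\<in>?F. \<forall>L\<in>?F. M \<subseteq> L \<longrightarrow> L = M"
    by (rule maximal_ideal_in_family)
  then obtain M where "M \<in> ?F" and max: "\<forall>L\<in>?F. M \<subseteq> L \<longrightarrow> L = M"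
    by (elim bexE) (rule that)
  then obtain f where f: "f \<notin> J" "M = {g. g * f \<in> J}" by auto
  have "a \<in> M \<or> b \<in> M" if ab: "a * b \<in> M" for a b
  proof (cases "a \<in> M")
    case False
    have "M \<subseteq> {g. g * (a * f) \<in> J}"
      unfolding f(2) by (rule quotient_elem_mono[OF J])
    then have "{g. g * (a * f) \<in> J} = M"
      using False f(2) by (intro max[rule_format]) auto
    moreover have "b * (a * f) \<in> J" using ab f(2) by (simp add: ac_simps)
    ultimately show ?thesis by blast
  qed simp
  then have "primeideal M mpoly_ring"
    using f quotient_elem_ideal[OF J] by (simp add: primeideal_type_iff)
  then show ?thesis using that f(2) by simp
qed

text \<open>
  Take \<open>M = (J : s)\<close> maximal with \<open>s\<close> outside \<open>Q\<close>; it is the contraction of the localisation of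
  \<open>J\<close> at \<open>Q\<close>.  Multiplication by an element outside \<open>Q\<close> is then injective modulo \<open>M\<close>, so a proper
  \<open>(M : f)\<close> is contained in \<open>Q\<close>.  An associated prime \<open>(M : f)\<close> of \<open>M\<close> is
  the associated prime \<open>(J : f s)\<close> of \<open>J\<close>.
\<close>

lemma prime_contains_associated_prime:
  assumes J: "ideal J mpoly_ring" and Q: "primeideal Q mpoly_ring" and JQ: "J \<subseteq> Q"
  obtains P where "P \<in> Ass J" "P \<subseteq> Q"
proof -
  let ?F = "(\<lambda>s. {g. g * s \<in> J}) ` (- Q)"
  have "1 \<notin> Q" using Q by (simp add: primeideal_type_iff)
  then have "{g. g * 1 \<in> J} \<in> ?F" by (intro image_eqI[of _ _ 1]) simp_all
  moreover have "ideal M mpoly_ring" if "M \<in> ?F" for M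
    using that quotient_elem_ideal[OF J] by auto
  ultimately have "\<exists>M\<in>?F. \<forall>L\<in>?F. M \<subseteq> L \<longrightarrow> L = M"
    by (rule maximal_ideal_in_family)
  then obtain M where "M \<in> ?F" and max: "\<forall>L\<in>?F. M \<subseteq> L \<longrightarrow> L = M"
    by (elim bexE) (rule that)
  then obtain s where s: "s \<notin> Q" "M = {g. g * s \<in> J}" by auto
  have M: "ideal M mpoly_ring" using quotient_elem_ideal[OF J] s(2) by simp
  have saturated: "x \<in> M" if "y \<notin> Q" "y * x \<in> M" for x y
  proof -
    have "M \<subseteq> {g. g * (y * s) \<in> J}"
      unfolding s(2) by (rule quotient_elem_mono[OF J])
    moreover have "y * s \<notin> Q" using that(1) s(1) Q by (auto simp: primeideal_type_iff)
    ultimately have "{g. g * (y * s) \<in> J} = M" by (intro max[rule_format]) auto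
    moreover have "x * (y * s) \<in> J" using that(2) s(2) by (simp add: ac_simps)
    ultimately show ?thesis by blast
  qed
  have "1 \<notin> M" using s JQ by auto
  then obtain f where f: "primeideal {g. g * f \<in> M} mpoly_ring" using ex_associated_prime[OF M] by blast
  have "{g. g * f \<in> M} = colon_elem J (f * s)"
    by (simp add: colon_elem_eq[OF J] s(2) mult.assoc)
  then have "{g. g * f \<in> M} \<in> Ass J" using f by (auto simp: Ass_def)
  moreover have "f \<notin> M" using f by (auto simp: primeideal_type_iff)
  then have "{g. g * f \<in> M} \<subseteq> Q" using saturated by blast
  ultimately show ?thesis using that by blast
qed

text \<open>
  If \<open>Idl F\<close> is maximal among the ideals generated by finite subsets of \<open>G\<close>, adding one more element
  of \<open>G\<close> to \<open>F\<close> does not enlarge it, so it contains \<open>G\<close>.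
\<close>

lemma finite_generating_subset:
  obtains F where "finite F" "F \<subseteq> G" "Idl\<^bsub>mpoly_ring\<^esub> F = Idl\<^bsub>mpoly_ring\<^esub> G"
proof -
  let ?F = "(\<lambda>F. Idl\<^bsub>mpoly_ring\<^esub> F) ` {F. finite F \<and> F \<subseteq> G}"
  have "Idl\<^bsub>mpoly_ring\<^esub> {} \<in> ?F" by blast
  moreover have "ideal M mpoly_ring" if "M \<in> ?F" for M
    using that Idl_ideal by auto
  ultimately have "\<exists>M\<in>?F. \<forall>L\<in>?F. M \<subseteq> L \<longrightarrow> L = M"
    by (rule maximal_ideal_in_family)
  then obtain M where "M \<in> ?F" and max: "\<forall>L\<in>?F. M \<subseteq> L \<longrightarrow> L = M"
    by (elim bexE) (rule that)
  then obtain F where F: "finite F" "F \<subseteq> G" "M = Idl\<^bsub>mpoly_ring\<^esub> F" by auto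
  have "x \<in> M" if "x \<in> G" for x
  proof -
    have "F \<subseteq> Idl\<^bsub>mpoly_ring\<^esub> (insert x F)" using Idl_superset by blast
    then have "M \<subseteq> Idl\<^bsub>mpoly_ring\<^esub> (insert x F)"
      unfolding F(3) by (rule Idl_least[OF Idl_ideal])
    then have "Idl\<^bsub>mpoly_ring\<^esub> (insert x F) = M" using F that by (intro max[rule_format]) auto
    then show ?thesis using Idl_superset[of "insert x F"] by auto
  qed
  then have "Idl\<^bsub>mpoly_ring\<^esub> G \<subseteq> M" using F(3) Idl_ideal by (intro Idl_least) auto
  moreover have "M \<subseteq> Idl\<^bsub>mpoly_ring\<^esub> G"
    unfolding F(3) using F(2) Idl_superset by (intro Idl_least[OF Idl_ideal]) blast
  ultimately show ?thesis using that F by blast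
qed

section \<open>Initial degrees and powers of equigenerated ideals\<close>

lemma alpha_le: "f \<in> I \<Longrightarrow> f \<noteq> 0 \<Longrightarrow> f \<in> graded_part d \<Longrightarrow> alpha I \<le> d"
  unfolding alpha_def by (intro Least_le bexI[of _ f]) simp_all

lemma alpha_witness:
  assumes "f \<in> I" "f \<noteq> 0" "f \<in> graded_part d"
  obtains g where "g \<in> I" "g \<noteq> 0" "g \<in> graded_part (alpha I)"
proof -
  have "\<exists>g\<in>I - {0}. g \<in> graded_part (alpha I)"
    unfolding alpha_def by (rule LeastI[of _ d]) (use assms in blast)
  then show ?thesis using that by blast
qed

lemma alpha_antimono:
  assumes "I \<subseteq> J" "f \<in> I" "f \<noteq> 0" "f \<in> graded_part d"
  shows "alpha J \<le> alpha I"
proof -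
  obtain g where "g \<in> I" "g \<noteq> 0" "g \<in> graded_part (alpha I)"
    using assms(2-4) by (rule alpha_witness)
  moreover from this have "g \<in> J" using assms(1) by auto
  ultimately show ?thesis by (intro alpha_le[of g])
qed

text \<open>
  The polynomials without terms of degree below \<open>d\<close> form an ideal that contains \<open>G\<close>.
\<close>

lemma generator_degree_le:
  assumes G: "G \<subseteq> graded_part d" and f: "f \<in> Idl\<^bsub>mpoly_ring\<^esub> G" "f \<noteq> 0" "f \<in> graded_part e"
  shows "d \<le> e"
proof -
  let ?H = "{h :: ('a, 'b) mpoly. \<forall>m\<in>Poly_Mapping.keys h. d \<le> mdeg m}"
  have "ideal ?H mpoly_ring"
    unfolding ideal_type_iff
  proof (intro conjI ballI allI CollectI)
    fix a b m assume ab: "a \<in> ?H" "b \<in> ?H" and m: "m \<in> Poly_Mapping.keys (a + b)"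
    then show "d \<le> mdeg m" using keys_add[of a b] by auto
  next
    fix a b m assume b: "b \<in> ?H" and m: "m \<in> Poly_Mapping.keys (a * b)"
    then obtain k l where "m = k + l" "l \<in> Poly_Mapping.keys b" using keys_mult[of a b] by auto
    then show "d \<le> mdeg m" using b by (auto simp: mdeg_add trans_le_add2)
  qed simp
  moreover have "G \<subseteq> ?H" using G by (auto simp: graded_part_def)
  ultimately have "f \<in> ?H" using f(1) Idl_least by blast
  moreover obtain m where "m \<in> Poly_Mapping.keys f" using f(2) by (metis all_not_in_conv keys_eq_empty)
  ultimately show ?thesis using f(3) by (auto simp: graded_part_def)
qed

lemma Idl_nonzero_generator:
  assumes "Idl\<^bsub>mpoly_ring\<^esub> G \<noteq> {0}"
  obtains g where "g \<in> G" "g \<noteq> 0"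
proof -
  have "\<not> G \<subseteq> {0}"
  proof
    assume "G \<subseteq> {0}"
    moreover have "ideal {0} mpoly_ring" by (simp add: ideal_type_iff)
    ultimately have "Idl\<^bsub>mpoly_ring\<^esub> G \<subseteq> {0}" by (intro Idl_least)
    then show False using assms ideal_zero[OF Idl_ideal, of G] by blast
  qed
  then show ?thesis using that by blast
qed

lemma alpha_equigenerated:
  assumes G: "G \<subseteq> graded_part d" and "Idl\<^bsub>mpoly_ring\<^esub> G \<noteq> {0}"
  shows "alpha (Idl\<^bsub>mpoly_ring\<^esub> G) = d"
proof -
  obtain g where g: "g \<in> G" "g \<noteq> 0" using Idl_nonzero_generator[OF assms(2)] .
  then have *: "g \<in> Idl\<^bsub>mpoly_ring\<^esub> G" "g \<in> graded_part d" using Idl_superset G by auto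
  then obtain h where "h \<in> Idl\<^bsub>mpoly_ring\<^esub> G" "h \<noteq> 0" "h \<in> graded_part (alpha (Idl\<^bsub>mpoly_ring\<^esub> G))"
    using alpha_witness g(2) by blast
  then show ?thesis using generator_degree_le[OF G] alpha_le * g(2) by (metis le_antisym)
qed

lemma ideal_power_0: "ideal_power I 0 = UNIV"
  by (simp add: ideal_power_def ideals_set_def nat_pow_def ring_of_type_algebra_def)

lemma ideal_power_Suc: "ideal_power I (Suc k) = ideal_prod mpoly_ring (ideal_power I k) I"
  by (simp add: ideal_power_def ideals_set_def nat_pow_def)

lemma ideal_power_ideal:
  assumes "ideal I (mpoly_ring :: ('n::finite, 'k::field) mpoly ring)"
  shows "ideal (ideal_power I k) mpoly_ring"
proof (induction k)
  case 0
  show ?case by (simp add: ideal_power_0 ideal_type_iff)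
next
  case (Suc k)
  interpret R: cring "mpoly_ring :: ('n, 'k) mpoly ring" by (rule cring_from_type_algebra)
  show ?case unfolding ideal_power_Suc by (rule R.ideal_prod_is_ideal[OF Suc assms])
qed

lemma mult_mem_ideal_prod:
  "a \<in> I \<Longrightarrow> b \<in> J \<Longrightarrow> a * b \<in> ideal_prod mpoly_ring I J"
  using ideal_prod.prod[of a I b J mpoly_ring] by (simp add: ring_of_type_algebra_def)

lemma ideal_prod_least:
  assumes H: "ideal H mpoly_ring" and "\<And>a b. a \<in> I \<Longrightarrow> b \<in> J \<Longrightarrow> a * b \<in> H"
  shows "ideal_prod mpoly_ring I J \<subseteq> H"
proof
  fix x assume "x \<in> ideal_prod mpoly_ring I J"
  then show "x \<in> H"
    by induction (use assms ideal_add[OF H] in \<open>auto simp: ring_of_type_algebra_def\<close>)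
qed

lemma power_mem_ideal_power: "a \<in> I \<Longrightarrow> a ^ k \<in> ideal_power I k"
proof (induction k)
  case (Suc k)
  then show ?case using mult_mem_ideal_prod[of "a ^ k" "ideal_power I k" a I]
    by (simp add: ideal_power_Suc mult.commute)
qed (simp add: ideal_power_0)

text \<open>
  The products of \<open>k\<close> elements of \<open>G\<close> generate the power; for \<open>k = 0\<close> the generator is \<open>1\<close>.
\<close>

lemma ideal_power_equigenerated:
  fixes G :: "('n::finite, 'k::field) mpoly set"
  assumes G: "G \<subseteq> graded_part d"
  obtains H where "H \<subseteq> graded_part (d * k)" "ideal_power (Idl\<^bsub>mpoly_ring\<^esub> G) k = Idl\<^bsub>mpoly_ring\<^esub> H"
proof (induction k arbitrary: thesis)
  case 0
  have "x \<in> Idl\<^bsub>mpoly_ring\<^esub> {1}" for x :: "('n, 'k) mpoly"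
    using ideal_mult[OF Idl_ideal, of 1 "{1}" x] Idl_superset[of "{1 :: ('n, 'k) mpoly}"] by auto
  then have "ideal_power (Idl\<^bsub>mpoly_ring\<^esub> G) 0 = Idl\<^bsub>mpoly_ring\<^esub> {1}"
    by (auto simp: ideal_power_0)
  moreover have "{1 :: ('n, 'k) mpoly} \<subseteq> graded_part (d * 0)"
    by (simp add: graded_part_def mdeg_def)
  ultimately show ?case using 0 by blast
next
  case (Suc k)
  obtain H where H: "H \<subseteq> graded_part (d * k)"
      "ideal_power (Idl\<^bsub>mpoly_ring\<^esub> G) k = Idl\<^bsub>mpoly_ring\<^esub> H"
    using Suc.IH by blast
  let ?HG = "{a * b |a b. a \<in> H \<and> b \<in> G}"
  let ?I = "Idl\<^bsub>mpoly_ring\<^esub> ?HG"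
  have I: "ideal ?I mpoly_ring" by (rule Idl_ideal)
  have 1: "a * b \<in> ?I" if "a \<in> H" "b \<in> Idl\<^bsub>mpoly_ring\<^esub> G" for a b
  proof -
    have "ideal {b. a * b \<in> ?I} mpoly_ring"
      using quotient_ideal[OF I, of "{a}"] by (simp add: mult.commute)
    moreover have "G \<subseteq> {b. a * b \<in> ?I}" using that(1) Idl_superset[of ?HG] by blast
    ultimately show ?thesis using Idl_least that(2) by blast
  qed
  have 2: "a * b \<in> ?I" if "a \<in> Idl\<^bsub>mpoly_ring\<^esub> H" "b \<in> Idl\<^bsub>mpoly_ring\<^esub> G" for a b
    using Idl_least[OF quotient_elem_ideal[OF I, of b], of H] 1 that by blast
  have "ideal_power (Idl\<^bsub>mpoly_ring\<^esub> G) (Suc k) \<subseteq> ?I"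
    unfolding ideal_power_Suc H(2) by (rule ideal_prod_least[OF I 2])
  moreover have "?I \<subseteq> ideal_power (Idl\<^bsub>mpoly_ring\<^esub> G) (Suc k)"
  proof (rule Idl_least[OF ideal_power_ideal[OF Idl_ideal]])
    show "?HG \<subseteq> ideal_power (Idl\<^bsub>mpoly_ring\<^esub> G) (Suc k)"
      unfolding ideal_power_Suc H(2)
      using Idl_superset[of H] Idl_superset[of G] mult_mem_ideal_prod by blast
  qed
  moreover have "?HG \<subseteq> graded_part (d * Suc k)"
    using H(1) G graded_part_mult by (fastforce simp: add.commute)
  ultimately show ?case using Suc.prems by blast
qed

lemma ideal_power_1:
  assumes I: "ideal I mpoly_ring"
  shows "ideal_power I 1 = I"
proof -
  have "ideal_power I 1 \<subseteq> I"
    unfolding One_nat_def ideal_power_Suc using ideal_mult[OF I] by (intro ideal_prod_least[OF I])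
  then show ?thesis using power_mem_ideal_power[of _ I 1] by auto
qed

section \<open>Local and global v-numbers\<close>

lemma Ass_superset:
  assumes J: "ideal J mpoly_ring" and "P \<in> Ass J"
  shows "J \<subseteq> P"
proof
  obtain f where f: "P = {g. g * f \<in> J}"
    using assms(2) by (auto simp: Ass_def colon_elem_eq[OF J])
  fix g assume "g \<in> J"
  then show "g \<in> P" unfolding f by (simp add: ideal_mult2[OF J])
qed

lemma v_local_le: "f \<in> graded_part d \<Longrightarrow> colon_elem J f = P \<Longrightarrow> v_local P J \<le> d"
  unfolding v_local_def by (intro Least_le bexI[of _ f])

lemma v_local_witness:
  assumes "graded_ideal J" "P \<in> Ass J"
  obtains f where "f \<in> graded_part (v_local P J)" "colon_elem J f = P"
proof -
  obtain d f where "f \<in> graded_part d" "colon_elem J f = P"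
    using homogeneous_witness[OF assms] .
  then have "\<exists>f\<in>graded_part (v_local P J). colon_elem J f = P"
    unfolding v_local_def
    by (rule LeastI[of "\<lambda>d. \<exists>f\<in>graded_part d. colon_elem J f = P", OF bexI, rotated])
  then show ?thesis using that by blast
qed

lemma v_number_le:
  assumes "f \<in> graded_part d" "P \<in> Ass J" "colon_elem J f = P"
  shows "v_number J \<le> d"
  unfolding v_number_def using assms by (intro Least_le bexI[of _ f] bexI[of _ P])

lemma v_number_witness:
  assumes "graded_ideal J" "P \<in> Ass J"
  obtains f Q where "f \<in> graded_part (v_number J)" "Q \<in> Ass J" "colon_elem J f = Q"
proof -
  obtain d f where "f \<in> graded_part d" "colon_elem J f = P"
    using homogeneous_witness[OF assms] .
  then have "\<exists>f\<in>graded_part (v_number J). \<exists>Q\<in>Ass J. colon_elem J f = Q"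
    unfolding v_number_def using assms(2)
    by (intro LeastI[of "\<lambda>d. \<exists>f\<in>graded_part d. \<exists>Q\<in>Ass J. colon_elem J f = Q" d]
        bexI[of _ f] bexI[of _ P])
  then show ?thesis using that by blast
qed

text \<open>
  Multiplying \<open>f\<close> by a nonzero homogeneous element of \<open>P\<close> of degree \<open>alpha P\<close> gives a
  nonzero homogeneous element of \<open>J\<close>, whose degree is at least \<open>D\<close>.
\<close>

lemma degree_witness_lower_bound:
  assumes G: "G \<subseteq> graded_part D" and "J = Idl\<^bsub>mpoly_ring\<^esub> G" and nz: "J \<noteq> {0}"
    and P: "P \<in> Ass J" and f: "f \<in> graded_part e" "colon_elem J f = P"
  shows "D \<le> e + alpha P"
proof -
  have J: "ideal J mpoly_ring" by (simp add: assms(2) Idl_ideal)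
  obtain g where g: "g \<in> G" "g \<noteq> 0" using Idl_nonzero_generator nz assms(2) by blast
  then have "g \<in> P" "g \<in> graded_part D"
    using Ass_superset[OF J P] Idl_superset[of G] assms(2) G by auto
  then obtain h where h: "h \<in> P" "h \<noteq> 0" "h \<in> graded_part (alpha P)"
    using alpha_witness g(2) by blast
  have "1 \<notin> P" using P by (auto simp: Ass_def primeideal_type_iff)
  then have "f \<noteq> 0" using f(2) ideal_zero[OF J] by (auto simp: colon_elem_eq[OF J])
  then have "h * f \<noteq> 0" using h(2) mpoly_mult_nonzero by blast
  moreover have "h * f \<in> J" using h(1) f(2) by (auto simp: colon_elem_eq[OF J])
  ultimately have "D \<le> alpha P + e"
    using generator_degree_le[OF G] graded_part_mult[OF h(3) f(1)] assms(2) by blast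
  then show ?thesis by simp
qed

text \<open>
  By strong persistence, \<open>P\<close> consists of the \<open>g\<close> with \<open>g f h \<in> I\<^sup>k\<^sup>+\<^sup>1\<close> for all \<open>h\<close> in a finite set of
  generators of \<open>I\<close>, so \<open>f h\<close> is a witness for one of these \<open>h\<close>.
\<close>

lemma witness_next_power:
  assumes G: "G \<subseteq> graded_part d" and I: "I = Idl\<^bsub>mpoly_ring\<^esub> G"
    and sp: "strong_persistence I" and "k \<ge> 1"
    and P: "primeideal P mpoly_ring"
    and f: "f \<in> graded_part e" "colon_elem (ideal_power I k) f = P"
  obtains f' where "f' \<in> graded_part (e + d)" "colon_elem (ideal_power I (Suc k)) f' = P"
proof -
  let ?J = "ideal_power I (Suc k)"
  have idI: "ideal I mpoly_ring" by (simp add: I Idl_ideal)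
  note J = ideal_power_ideal[OF idI, of "Suc k"]
  obtain F where F: "finite F" "F \<subseteq> G" "Idl\<^bsub>mpoly_ring\<^esub> F = I"
    using finite_generating_subset I by metis
  have pow: "ideal_power I k = {g. \<forall>h\<in>I. g * h \<in> ?J}"
    using sp \<open>k \<ge> 1\<close> by (auto simp: strong_persistence_def colon_def)
  have "(\<forall>h\<in>I. g * h \<in> ?J) \<longleftrightarrow> (\<forall>h\<in>F. g * h \<in> ?J)" for g
  proof
    assume "\<forall>h\<in>F. g * h \<in> ?J"
    moreover have "ideal {h. g * h \<in> ?J} mpoly_ring"
      using quotient_ideal[OF J, of "{g}"] by (simp add: mult.commute)
    ultimately show "\<forall>h\<in>I. g * h \<in> ?J" using Idl_least[of _ F] F(3) by blast
  qed (use F(3) Idl_superset in blast)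
  moreover have "P = {g. g * f \<in> ideal_power I k}"
    using f(2) by (simp add: colon_elem_eq[OF ideal_power_ideal[OF idI]])
  ultimately have "P = {g. \<forall>x\<in>(\<lambda>h. f * h) ` F. g * x \<in> ?J}"
    by (simp add: pow mult.assoc)
  then obtain h where "h \<in> F" "P = {g. g * (f * h) \<in> ?J}"
    using prime_eq_quotient_single[OF J P, of "(\<lambda>h. f * h) ` F"] F(1) by auto
  moreover from this have "f * h \<in> graded_part (e + d)"
    using f(1) F(2) G by (blast intro: graded_part_mult)
  ultimately show ?thesis using that by (simp add: colon_elem_eq[OF J])
qed

lemma ideal_power_nonzero:
  assumes I: "ideal I mpoly_ring" "I \<noteq> {0}"
  shows "ideal_power I k \<noteq> {0}"
proof -
  obtain a where a: "a \<in> I" "a \<noteq> 0" using I(2) ideal_zero[OF I(1)] by blast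
  have "a ^ k \<noteq> 0"
    by (induction k) (simp_all add: mpoly_mult_nonzero[OF a(2)])
  then show ?thesis using power_mem_ideal_power[OF a(1)] by blast
qed

text \<open>
  The sum \<open>e + alpha P = d k\<close> is an invariant of the step from one power to the next, and the
  general lower bound shows that a witness of such a degree \<open>e\<close> is optimal.
\<close>

lemma v_local_ideal_power:
  assumes I: "I \<noteq> {0}" "equigenerated I" "strong_persistence I" and P: "P \<in> Ass I"
    and v: "v_local P I + alpha P = alpha I" and k: "k \<ge> 1"
  shows "P \<in> Ass (ideal_power I k)"
    and "v_local P (ideal_power I k) + alpha P = alpha I * k"
proof -
  obtain d G where G: "G \<subseteq> graded_part d" "I = Idl\<^bsub>mpoly_ring\<^esub> G"
    using I(2) by (auto simp: equigenerated_def)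
  have d: "alpha I = d" using alpha_equigenerated[OF G(1)] G(2) I(1) by simp
  have gr: "graded_ideal I" using equigenerated_graded_ideal G by blast
  have idI: "ideal I mpoly_ring" by (rule graded_ideal_is_ideal[OF gr])
  have pP: "primeideal P mpoly_ring" using P by (simp add: Ass_def)
  have "\<exists>e. \<exists>f\<in>graded_part e. e + alpha P = d * k \<and> colon_elem (ideal_power I k) f = P"
    using k
  proof (induction k rule: nat_induct_at_least)
    case base
    obtain f where "f \<in> graded_part (v_local P I)" "colon_elem I f = P"
      using v_local_witness[OF gr P] .
    then show ?case using v d ideal_power_1[OF idI] by auto
  next
    case (Suc k)
    then obtain e f where e: "e + alpha P = d * k"
      and f: "f \<in> graded_part e" "colon_elem (ideal_power I k) f = P" by blast
    obtain f' where "f' \<in> graded_part (e + d)" "colon_elem (ideal_power I (Suc k)) f' = P"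
      using witness_next_power[OF G I(3) Suc.hyps pP f] .
    moreover have "(e + d) + alpha P = d * Suc k" using e by simp
    ultimately show ?case by blast
  qed
  then obtain e f where e: "e + alpha P = d * k"
    and f: "f \<in> graded_part e" "colon_elem (ideal_power I k) f = P" by blast
  show ass: "P \<in> Ass (ideal_power I k)" using pP f(2) by (auto simp: Ass_def)
  obtain H where H: "H \<subseteq> graded_part (d * k)" "ideal_power I k = Idl\<^bsub>mpoly_ring\<^esub> H"
    using ideal_power_equigenerated[OF G(1)] G(2) by metis
  have "graded_ideal (ideal_power I k)" using equigenerated_graded_ideal H by metis
  then obtain h where "h \<in> graded_part (v_local P (ideal_power I k))"
      "colon_elem (ideal_power I k) h = P" using v_local_witness ass by blast
  then have "d * k \<le> v_local P (ideal_power I k) + alpha P"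
    using degree_witness_lower_bound[OF H] ideal_power_nonzero[OF idI I(1)] ass by blast
  moreover have "v_local P (ideal_power I k) \<le> e" using f by (rule v_local_le)
  ultimately show "v_local P (ideal_power I k) + alpha P = alpha I * k" using e d by simp
qed

text \<open>
  Every associated prime of \<open>I\<^sup>k\<close> contains one of \<open>I\<close>, so its initial degree is at most
  \<open>c_number I\<close>; thus no prime that is new in \<open>I\<^sup>k\<close> can give a witness of degree below the one
  that comes from \<open>I\<close>.
\<close>

lemma v_number_ideal_power:
  assumes I: "I \<noteq> {0}" "I \<noteq> UNIV" "equigenerated I" "strong_persistence I"
    and v: "v_number I + c_number I = alpha I" and k: "k \<ge> 1"
  shows "v_number (ideal_power I k) + c_number I = alpha I * k"
proof -
  obtain d G where G: "G \<subseteq> graded_part d" "I = Idl\<^bsub>mpoly_ring\<^esub> G"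
    using I(3) by (auto simp: equigenerated_def)
  have d: "alpha I = d" using alpha_equigenerated[OF G(1)] G(2) I(1) by simp
  have gr: "graded_ideal I" using equigenerated_graded_ideal G by blast
  have idI: "ideal I mpoly_ring" by (rule graded_ideal_is_ideal[OF gr])
  obtain g where "g \<in> G" "g \<noteq> 0" using Idl_nonzero_generator[of G] G(2) I(1) by blast
  then have g: "g \<in> I" "g \<noteq> 0" "g \<in> graded_part d" using G Idl_superset[of G] by auto
  have "alpha Q \<le> alpha I" if "Q \<in> Ass I" for Q
    using alpha_antimono[OF Ass_superset[OF idI that] g] .
  then have "finite (alpha ` Ass I)" by (auto simp: finite_nat_set_iff_bounded_le)
  then have c: "alpha Q \<le> c_number I" if "Q \<in> Ass I" for Q
    using that by (simp add: c_number_def)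
  have "1 \<notin> I" using I(2) ideal_mult[OF idI, of 1] by auto
  then obtain f\<^sub>0 where "primeideal {g. g * f\<^sub>0 \<in> I} mpoly_ring"
    using ex_associated_prime[OF idI] by blast
  then have "{g. g * f\<^sub>0 \<in> I} \<in> Ass I" by (auto simp: Ass_def colon_elem_eq[OF idI])
  then obtain f P where f: "f \<in> graded_part (v_number I)" "P \<in> Ass I" "colon_elem I f = P"
    using v_number_witness[OF gr] by blast
  have "alpha I \<le> v_number I + alpha P"
    using degree_witness_lower_bound[OF G I(1) f(2,1,3)] d by simp
  then have alphaP: "alpha P = c_number I" using c[OF f(2)] v by simp
  obtain h where "h \<in> graded_part (v_local P I)" "colon_elem I h = P"
    using v_local_witness[OF gr f(2)] .
  then have "v_number I \<le> v_local P I" using f(2) v_number_le by blast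
  moreover have "v_local P I \<le> v_number I" using f(1,3) by (rule v_local_le)
  ultimately have vP: "v_local P I + alpha P = alpha I" using v alphaP by simp
  let ?J = "ideal_power I k"
  have PJ: "P \<in> Ass ?J" "v_local P ?J + alpha P = alpha I * k"
    using v_local_ideal_power[OF I(1,3,4) f(2) vP k] .
  obtain H where H: "H \<subseteq> graded_part (d * k)" "?J = Idl\<^bsub>mpoly_ring\<^esub> H"
    using ideal_power_equigenerated[OF G(1)] G(2) by metis
  have grJ: "graded_ideal ?J" using equigenerated_graded_ideal H by metis
  obtain h' where "h' \<in> graded_part (v_local P ?J)" "colon_elem ?J h' = P"
    using v_local_witness[OF grJ PJ(1)] .
  then have "v_number ?J \<le> v_local P ?J" using PJ(1) v_number_le by blast
  then have upper: "v_number ?J + c_number I \<le> alpha I * k" using PJ(2) alphaP by simp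
  obtain q Q where q: "q \<in> graded_part (v_number ?J)" "Q \<in> Ass ?J" "colon_elem ?J q = Q"
    using v_number_witness[OF grJ PJ(1)] .
  have lower: "alpha I * k \<le> v_number ?J + alpha Q"
    using degree_witness_lower_bound[OF H ideal_power_nonzero[OF idI I(1)] q(2,1,3)] d by simp
  have pQ: "primeideal Q mpoly_ring" using q(2) by (simp add: Ass_def)
  have "I \<subseteq> Q"
  proof
    fix x assume "x \<in> I"
    then have "x ^ k \<in> Q"
      using power_mem_ideal_power Ass_superset[OF ideal_power_ideal[OF idI] q(2)] by blast
    then show "x \<in> Q" by (rule prime_power_mem[OF pQ])
  qed
  then obtain P' where P': "P' \<in> Ass I" "P' \<subseteq> Q"
    using prime_contains_associated_prime[OF idI pQ] by blast
  have "alpha Q \<le> alpha P'"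
    using alpha_antimono[OF P'(2) _ g(2,3)] Ass_superset[OF idI P'(1)] g(1) by blast
  then show ?thesis using c[OF P'(1)] lower upper by simp
qed

theorem proposition3p4:
  fixes I :: "('n::finite, 'k::field) mpoly set"
  assumes "ideal I mpoly_ring"
    and "I \<noteq> {0}"
    and "I \<noteq> UNIV"
    and "graded_ideal I"
    and "equigenerated I"
    and "strong_persistence I"
  shows "(\<forall>P\<in>Ass I. int (v_local P I) = int (alpha I) - int (alpha P) \<longrightarrow>
            (\<forall>k\<ge>1. P \<in> Ass (ideal_power I k) \<and>
               int (v_local P (ideal_power I k)) = int (alpha I) * int k - int (alpha P))) \<and>
         (int (v_number I) = int (alpha I) - int (c_number I) \<longrightarrow>
            (\<forall>k\<ge>1. int (v_number (ideal_power I k)) = int (alpha I) * int k - int (c_number I)))"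
proof -
  have nat_eq: "int a = int b - int c \<longleftrightarrow> a + c = b" for a b c by linarith
  show ?thesis
    unfolding of_nat_mult[symmetric] nat_eq
    using v_local_ideal_power[OF assms(2,5,6)] v_number_ideal_power[OF assms(2,3,5,6)]
    by blast
qed

end
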